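(* Let $d\geq 3$ and let $P\subset\mathbb R^d$ be a full-dimensional polytope. For any two admissible orthogonals $V_0,V_1$ of $P$ there is a continuous path $\gamma$ between $V_0$ and $V_1$ such that the set of $t\in[0,1]$ for which $V_t=\mathrm{Span}(\gamma(t))$ is not an admissible orthogonal is finite, and for each such $t$ exactly one class of 2-faces of $P$ is degenerating for $V_t^\perp$.
   Context: For a $2$-face $F$ of $P$, $\mathrm{Span}[F]$ is the unique $2$-dimensional linear subspace parallel to $F$; parallel 2-faces (same $\mathrm{Span}[\cdot]$) form classes. For a $2$-dimensional subspace $W$, a 2-face $F$ is degenerating for $W$ if its orthogonal projection onto $W$ is contained in a line, equivalently $W^\perp\cap\mathrm{Span}[F]\neq\{0\}$; a class degenerates if its representatives do. $W$ is admissible if no 2-face of $P$ degenerates for $W$; a $(d-2)$-dimensional subspace $V$ is an admissible orthogonal if $V^\perp$ is admissible. A continuous path between two $k$-dimensional subspaces $V_0,V_1$ is a map $\gamma:[0,1]\to(\mathbb R^d)^k$ such that (1) $\gamma(t)$ is a linearly independent family for all $t$; (2) $\mathrm{Span}(\gamma(0))=V_0$ and $\mathrm{Span}(\gamma(1))=V_1$; (3) $\gamma$ is continuous except at finitely many points $0<t_1<\dots<t_n<1$, where it has one-sided limits $\gamma(t_i^-),\gamma(t_i^+)$ with $\mathrm{Span}(\gamma(t_i^-))=\mathrm{Span}(\gamma(t_i^+))=\mathrm{Span}(\gamma(t_i))$. Here $k=d-2$. *)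

theory Defs
  imports "HOL-Analysis.Analysis"
begin

definition two_face :: "'a::euclidean_space set \<Rightarrow> 'a set \<Rightarrow> bool" where
  "two_face P F \<longleftrightarrow> F face_of P \<and> aff_dim F = 2"

text \<open>The linear subspace parallel to a nonempty set \<open>F\<close>, written \<open>Span[F]\<close> on paper. It is not the
  linear span of \<open>F\<close> itself.\<close>

definition direction_space :: "'a::euclidean_space set \<Rightarrow> 'a set" where
  "direction_space F = (THE L. subspace L \<and> affine_parallel (affine hull F) L)"

lemma direction_space:
  assumes "F \<noteq> {}"
  shows "subspace (direction_space F)" "affine_parallel (affine hull F) (direction_space F)"
proof -
  have "\<exists>!L. subspace L \<and> affine_parallel (affine hull F) L"
    using assms by (intro affine_parallel_subspace) auto
  from theI'[OF this] show "subspace (direction_space F)"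
    "affine_parallel (affine hull F) (direction_space F)"
    unfolding direction_space_def by auto
qed

lemma direction_space_eqI:
  assumes "F \<noteq> {}" "subspace L" "affine_parallel (affine hull F) L"
  shows "direction_space F = L"
  using assms direction_space parallel_subspace affine_parallel_assoc affine_parallel_commute
  by metis

lemma dim_direction_space:
  assumes "F \<noteq> {}"
  shows "int (dim (direction_space F)) = aff_dim F"
  using aff_dim_parallel_subspace[OF assms direction_space[OF assms]] by simp

lemma direction_space_eq_span:
  assumes "a \<in> F"
  shows "direction_space F = span ((\<lambda>x. - a + x) ` F)"
proof (rule direction_space_eqI)
  have "affine hull F = (+) a ` span ((\<lambda>x. - a + x) ` F)"
    using affine_hull_span_gen[of a F] assms hull_inc by (metis (no_types))
  then show "affine_parallel (affine hull F) (span ((\<lambda>x. - a + x) ` F))"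
    using affine_parallel_commute affine_parallel_def by blast
qed (use assms in auto)

definition parallel_classes :: "'a::euclidean_space set \<Rightarrow> 'a set set set" where
  "parallel_classes P = {F. two_face P F} //
     {(F, G). two_face P F \<and> two_face P G \<and> direction_space F = direction_space G}"

definition orth_proj :: "'a::euclidean_space set \<Rightarrow> 'a \<Rightarrow> 'a" where
  "orth_proj W x = (THE y. y \<in> W \<and> x - y \<in> W\<^sup>\<bottom>)"

definition degenerates :: "'a::euclidean_space set \<Rightarrow> 'a set \<Rightarrow> bool" where
  "degenerates W F \<longleftrightarrow> collinear (orth_proj W ` F)"

definition class_degenerates :: "'a::euclidean_space set \<Rightarrow> 'a set set \<Rightarrow> bool" where
  "class_degenerates W C \<longleftrightarrow> (\<forall>F\<in>C. degenerates W F)"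

lemma orth_proj_unique:
  assumes "subspace W" "y \<in> W" "x - y \<in> W\<^sup>\<bottom>"
  shows "orth_proj W x = y"
  unfolding orth_proj_def
proof (rule the_equality)
  fix z assume z: "z \<in> W \<and> x - z \<in> W\<^sup>\<bottom>"
  have "z - y \<in> W"
    using z assms subspace_diff by blast
  moreover have "(x - y) - (x - z) \<in> W\<^sup>\<bottom>"
    using z assms subspace_diff subspace_orthogonal_comp by blast
  ultimately show "z = y"
    by (auto simp: orthogonal_comp_def orthogonal_def)
qed (use assms in auto)

lemma orth_proj:
  assumes "subspace W"
  shows "orth_proj W x \<in> W" "x - orth_proj W x \<in> W\<^sup>\<bottom>"
proof -
  obtain y z where "y \<in> W" "z \<in> W\<^sup>\<bottom>" "x = y + z"
    using subspace_sum_orthogonal_comp[OF assms] by (metis UNIV_I set_plus_elim)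
  then have "orth_proj W x = y" "x - y \<in> W\<^sup>\<bottom>"
    using orth_proj_unique[OF assms] by auto
  with \<open>y \<in> W\<close> show "orth_proj W x \<in> W" "x - orth_proj W x \<in> W\<^sup>\<bottom>"
    by auto
qed

lemma linear_orth_proj:
  assumes "subspace W"
  shows "linear (orth_proj W)"
proof (rule linearI)
  fix x y
  have "x + y - (orth_proj W x + orth_proj W y)
      = (x - orth_proj W x) + (y - orth_proj W y)" by simp
  also have "\<dots> \<in> W\<^sup>\<bottom>"
    using orth_proj[OF assms] subspace_add subspace_orthogonal_comp by blast
  finally show "orth_proj W (x + y) = orth_proj W x + orth_proj W y"
    using orth_proj[OF assms] assms by (intro orth_proj_unique) (auto simp: subspace_add)
next
  fix c x
  have "c *\<^sub>R x - c *\<^sub>R orth_proj W x = c *\<^sub>R (x - orth_proj W x)"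
    by (simp add: algebra_simps)
  also have "\<dots> \<in> W\<^sup>\<bottom>"
    using orth_proj[OF assms] subspace_scale subspace_orthogonal_comp by blast
  finally show "orth_proj W (c *\<^sub>R x) = c *\<^sub>R orth_proj W x"
    using orth_proj[OF assms] assms by (intro orth_proj_unique) (auto simp: subspace_scale)
qed

lemma orth_proj_eq_0_iff:
  assumes "subspace W"
  shows "orth_proj W x = 0 \<longleftrightarrow> x \<in> W\<^sup>\<bottom>"
  using orth_proj[OF assms, of x] orth_proj_unique[OF assms, of 0 x] subspace_0[OF assms] by auto

lemma degenerates_iff:
  assumes "subspace W" "aff_dim F = 2"
  shows "degenerates W F \<longleftrightarrow> W\<^sup>\<bottom> \<inter> direction_space F \<noteq> {0}"
proof -
  let ?p = "orth_proj W" and ?D = "direction_space F"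
  have lin: "linear ?p" using assms linear_orth_proj by blast
  have ne: "F \<noteq> {}" using assms(2) by auto
  then obtain a where a: "a \<in> F" by blast
  have subD: "subspace ?D" using ne direction_space by blast
  have D2: "dim ?D = 2" using dim_direction_space[OF ne] assms(2) by simp
  have "(+) (- ?p a) ` ?p ` F = ?p ` (\<lambda>x. - a + x) ` F"
    by (simp add: image_image linear_diff[OF lin])
  then have "span ((+) (- ?p a) ` ?p ` F) = ?p ` ?D"
    using direction_space_eq_span[OF a] linear_span_image[OF lin] by metis
  then have "aff_dim (?p ` F) = int (dim (?p ` ?D))"
    using aff_dim_eq_dim[of "?p a" "?p ` F"] a by (metis dim_span hull_inc imageI)
  then have "degenerates W F \<longleftrightarrow> dim (?p ` ?D) \<le> 1"
    by (simp add: degenerates_def collinear_aff_dim)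
  also have "\<dots> \<longleftrightarrow> W\<^sup>\<bottom> \<inter> ?D \<noteq> {0}"
  proof
    assume le: "dim (?p ` ?D) \<le> 1"
    show "W\<^sup>\<bottom> \<inter> ?D \<noteq> {0}"
    proof
      assume "W\<^sup>\<bottom> \<inter> ?D = {0}"
      then have "inj_on ?p ?D"
        using linear_injective_on_subspace_0[OF lin subD] orth_proj_eq_0_iff[OF assms(1)] by blast
      then have "dim (?p ` ?D) = dim ?D"
        using dim_image_eq[OF lin] subD span_eq_iff by metis
      with le D2 show False by simp
    qed
  next
    assume "W\<^sup>\<bottom> \<inter> ?D \<noteq> {0}"
    then obtain v where v: "v \<in> ?D" "v \<in> W\<^sup>\<bottom>" "v \<noteq> 0"
      using subspace_0[OF subD] subspace_0[OF subspace_orthogonal_comp] by blast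
    obtain B where B: "{v} \<subseteq> B" "B \<subseteq> ?D" "independent B" "?D \<subseteq> span B"
      using maximal_independent_subset_extend[of "{v}" ?D] v by auto
    have fin: "finite B" and card: "card B = 2"
      using B D2 independent_imp_finite basis_card_eq_dim by metis+
    have "?p ` B \<subseteq> insert 0 (?p ` (B - {v}))"
      using v orth_proj_eq_0_iff[OF assms(1)] by auto
    then have "?p ` ?D \<subseteq> span (?p ` (B - {v}))"
      by (metis B(4) image_mono lin linear_span_image span_insert_0 span_mono subset_trans)
    then have "dim (?p ` ?D) \<le> card (?p ` (B - {v}))"
      using fin by (intro dim_le_card) auto
    also have "\<dots> \<le> card (B - {v})"
      using fin by (intro card_image_le) auto
    also have "\<dots> = 1"
      using B(1) card fin by simp
    finally show "dim (?p ` ?D) \<le> 1" .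
  qed
  finally show ?thesis .
qed

definition admissible :: "'a::euclidean_space set \<Rightarrow> 'a set \<Rightarrow> bool" where
  "admissible P W \<longleftrightarrow> subspace W \<and> dim W = 2 \<and> (\<forall>F. two_face P F \<longrightarrow> \<not> degenerates W F)"

definition admissible_orthogonal :: "'a::euclidean_space set \<Rightarrow> 'a set \<Rightarrow> bool" where
  "admissible_orthogonal P V \<longleftrightarrow> subspace V \<and> dim V = DIM('a) - 2 \<and> admissible P (V\<^sup>\<bottom>)"

text \<open>A \<open>k\<close>-tuple of vectors is a function on \<open>nat\<close> of which only the values below \<open>k\<close> matter;
  accordingly limits and continuity of curves of tuples are taken componentwise for indices below
  \<open>k\<close>.\<close>

definition lin_indep_tuple :: "nat \<Rightarrow> (nat \<Rightarrow> 'a::euclidean_space) \<Rightarrow> bool" where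
  "lin_indep_tuple k v \<longleftrightarrow> inj_on v {..<k} \<and> independent (v ` {..<k})"

definition tuple_span :: "nat \<Rightarrow> (nat \<Rightarrow> 'a::euclidean_space) \<Rightarrow> 'a set" where
  "tuple_span k v = span (v ` {..<k})"

definition subspace_path ::
    "nat \<Rightarrow> 'a::euclidean_space set \<Rightarrow> 'a set \<Rightarrow> (real \<Rightarrow> nat \<Rightarrow> 'a) \<Rightarrow> bool" where
  "subspace_path k V0 V1 \<gamma> \<longleftrightarrow>
     (\<forall>t\<in>{0..1}. lin_indep_tuple k (\<gamma> t)) \<and>
     tuple_span k (\<gamma> 0) = V0 \<and> tuple_span k (\<gamma> 1) = V1 \<and>
     (\<exists>T. finite T \<and> T \<subseteq> {0<..<1} \<and>
        (\<forall>i<k. continuous_on ({0..1} - T) (\<lambda>t. \<gamma> t i)) \<and>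
        (\<forall>t\<in>T. \<exists>l r.
           (\<forall>i<k. ((\<lambda>s. \<gamma> s i) \<longlongrightarrow> l i) (at_left t) \<and> ((\<lambda>s. \<gamma> s i) \<longlongrightarrow> r i) (at_right t)) \<and>
           tuple_span k l = tuple_span k (\<gamma> t) \<and> tuple_span k r = tuple_span k (\<gamma> t)))"

end

theory Submission
  imports Defs
begin

text \<open>An admissible orthogonal is a \<open>(d-2)\<close>-dimensional subspace meeting none of the finitely many
  planes \<open>Span[F]\<close>. We move one basis vector at a time, keeping fixed a \<open>(d-3)\<close>-dimensional \<open>U\<close>
  whose sums \<open>U + L\<close> with these planes are pairwise distinct hyperplanes. The moving vector
  \<open>x\<close> makes \<open>L\<close> degenerate precisely when \<open>x \<in> U + L\<close>, so a generic broken line crosses the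
  hyperplanes one at a time, at finitely many moments. Every admissible orthogonal contains
  such a \<open>U\<close>, and any two such \<open>U\<close> are connected by exchanging basis vectors for generic ones;
  the changes of basis in between are the discontinuities allowed in a path.\<close>

section \<open>Dimension counts and generic points\<close>

lemmas span_of_subspace = span_eq_iff[THEN iffD2]

lemma dim_insert_subspace:
  fixes U :: "'a::euclidean_space set"
  assumes "subspace U" "x \<notin> U"
  shows "dim (span (insert x U)) = dim U + 1"
  using dim_insert[of x U] span_of_subspace[OF assms(1)] assms(2) by simp

lemma dim_subspace_Un_Int:
  fixes S T :: "'a::euclidean_space set"
  assumes "subspace S" "subspace T"
  shows "dim (S \<union> T) + dim (S \<inter> T) = dim S + dim T"
proof -
  have "span (S \<union> T) = {x + y |x y. x \<in> S \<and> y \<in> T}"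
    using assms by (simp add: span_Un span_of_subspace)
  then have "dim (S \<union> T) = dim {x + y |x y. x \<in> S \<and> y \<in> T}"
    using dim_span[of "S \<union> T"] by simp
  then show ?thesis
    using dim_sums_Int[OF assms] by simp
qed

text \<open>Lower-dimensional sets are Lebesgue null, and finitely many null sets cannot fill the
  space. Every generic vector below is chosen this way.\<close>

lemma avoid_proper_subspaces:
  fixes \<A> :: "'a::euclidean_space set set"
  assumes "finite \<A>" "\<And>A. A \<in> \<A> \<Longrightarrow> dim A < DIM('a)"
  shows "\<exists>z. \<forall>A\<in>\<A>. z \<notin> A"
proof -
  have "negligible (\<Union>\<A>)"
    using assms by (intro negligible_Union) (auto intro: negligible_lowdim)
  then have "\<Union>\<A> \<noteq> UNIV"
    using non_negligible_UNIV by metis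
  then show ?thesis by blast
qed

section \<open>Concatenating paths of subspaces\<close>

lemma filterlim_affine_at_left:
  fixes a b c :: real
  assumes "c > 0"
  shows "filterlim (\<lambda>s. c * s + b) (at_left (c * a + b)) (at_left a)"
  unfolding filterlim_at
proof
  show "\<forall>\<^sub>F s in at_left a. c * s + b \<in> {..<c * a + b} \<and> c * s + b \<noteq> c * a + b"
    using assms by (auto simp: eventually_at_filter)
qed (intro tendsto_intros)

lemma filterlim_affine_at_right:
  fixes a b c :: real
  assumes "c > 0"
  shows "filterlim (\<lambda>s. c * s + b) (at_right (c * a + b)) (at_right a)"
  unfolding filterlim_at
proof
  show "\<forall>\<^sub>F s in at_right a. c * s + b \<in> {c * a + b<..} \<and> c * s + b \<noteq> c * a + b"
    using assms by (auto simp: eventually_at_filter)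
qed (intro tendsto_intros)

text \<open>Both paths reach the same subspace \<open>B\<close> at the junction, but possibly with
  different bases. The junction is therefore counted as a jump, at which both one-sided limits span
  \<open>B\<close>.\<close>

lemma subspace_path_join:
  assumes "subspace_path k A B \<gamma>1" "subspace_path k B C \<gamma>2"
  shows "subspace_path k A C (\<lambda>t. if t \<le> 1/2 then \<gamma>1 (2 * t) else \<gamma>2 (2 * t - 1))"
    (is "subspace_path k A C ?g")
proof -
  have ind1: "lin_indep_tuple k (\<gamma>1 t)" and ind2: "lin_indep_tuple k (\<gamma>2 t)" if "t \<in> {0..1}" for t
    using assms that by (auto simp: subspace_path_def)
  have ends: "tuple_span k (\<gamma>1 0) = A" "tuple_span k (\<gamma>1 1) = B"
    "tuple_span k (\<gamma>2 0) = B" "tuple_span k (\<gamma>2 1) = C"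
    using assms by (auto simp: subspace_path_def)
  obtain T1 where T1: "finite T1" "T1 \<subseteq> {0<..<1}"
    and cont1: "\<And>i. i < k \<Longrightarrow> continuous_on ({0..1} - T1) (\<lambda>t. \<gamma>1 t i)"
    and lim1: "\<And>t. t \<in> T1 \<Longrightarrow> \<exists>l r. (\<forall>i<k. ((\<lambda>s. \<gamma>1 s i) \<longlongrightarrow> l i) (at_left t) \<and>
        ((\<lambda>s. \<gamma>1 s i) \<longlongrightarrow> r i) (at_right t)) \<and>
        tuple_span k l = tuple_span k (\<gamma>1 t) \<and> tuple_span k r = tuple_span k (\<gamma>1 t)"
    using assms(1) unfolding subspace_path_def by metis
  obtain T2 where T2: "finite T2" "T2 \<subseteq> {0<..<1}"
    and cont2: "\<And>i. i < k \<Longrightarrow> continuous_on ({0..1} - T2) (\<lambda>t. \<gamma>2 t i)"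
    and lim2: "\<And>t. t \<in> T2 \<Longrightarrow> \<exists>l r. (\<forall>i<k. ((\<lambda>s. \<gamma>2 s i) \<longlongrightarrow> l i) (at_left t) \<and>
        ((\<lambda>s. \<gamma>2 s i) \<longlongrightarrow> r i) (at_right t)) \<and>
        tuple_span k l = tuple_span k (\<gamma>2 t) \<and> tuple_span k r = tuple_span k (\<gamma>2 t)"
    using assms(2) unfolding subspace_path_def by metis
  define T where "T = {t. 2 * t \<in> T1} \<union> {1/2} \<union> {t. 2 * t - 1 \<in> T2}"
  have "{t. 2 * t \<in> T1} = (\<lambda>t. t / 2) ` T1"
    by (auto intro: image_eqI[of _ _ "2 * t" for t])
  moreover have "{t. 2 * t - 1 \<in> T2} = (\<lambda>t. (t + 1) / 2) ` T2"
    by (auto simp: field_simps intro: image_eqI[of _ _ "2 * t - 1" for t])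
  ultimately have finT: "finite T"
    using T1 T2 by (simp add: T_def)
  have subT: "T \<subseteq> {0<..<1}"
    using T1(2) T2(2) by (force simp: T_def)
  have cont: "continuous_on ({0..1} - T) (\<lambda>t. ?g t i)" if i: "i < k" for i
  proof -
    have "continuous_on {t \<in> {0..1} - T. t \<le> 1/2} (\<lambda>t. \<gamma>1 (2 * t) i)"
      by (rule continuous_on_compose2[OF cont1[OF i]])
        (auto simp: T_def intro!: continuous_intros)
    moreover have "continuous_on {t \<in> {0..1} - T. 1/2 \<le> t} (\<lambda>t. \<gamma>2 (2 * t - 1) i)"
      by (rule continuous_on_compose2[OF cont2[OF i]])
        (auto simp: T_def intro!: continuous_intros)
    ultimately have "continuous_on ({0..1} - T)
        (\<lambda>t. if t \<le> 1/2 then \<gamma>1 (2 * t) i else \<gamma>2 (2 * t - 1) i)"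
      by (intro continuous_on_cases_le) (auto simp: T_def intro!: continuous_intros)
    then show ?thesis
      by (simp add: if_distrib if_distribR cong: if_cong)
  qed
  \<comment> \<open>A limit depends only on values near the point, where a single branch of the
    conditional is active.\<close>
  have half1: "((\<lambda>s. ?g s i) \<longlongrightarrow> m) F"
    if "((\<lambda>s. \<gamma>1 (2 * s) i) \<longlongrightarrow> m) F" "\<forall>\<^sub>F s in F. s < 1/2" for F m i
    using that(1) by (rule Lim_transform_eventually) (use that(2) in eventually_elim, auto)
  have half2: "((\<lambda>s. ?g s i) \<longlongrightarrow> m) F"
    if "((\<lambda>s. \<gamma>2 (2 * s - 1) i) \<longlongrightarrow> m) F" "\<forall>\<^sub>F s in F. s > 1/2" for F m i
    using that(1) by (rule Lim_transform_eventually) (use that(2) in eventually_elim, auto)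
  have jumps: "\<exists>l r. (\<forall>i<k. ((\<lambda>s. ?g s i) \<longlongrightarrow> l i) (at_left t) \<and> ((\<lambda>s. ?g s i) \<longlongrightarrow> r i) (at_right t)) \<and>
           tuple_span k l = tuple_span k (?g t) \<and> tuple_span k r = tuple_span k (?g t)"
    if "t \<in> T" for t
  proof -
    from that consider "2 * t \<in> T1" | "t = 1/2" | "2 * t - 1 \<in> T2"
      by (auto simp: T_def)
    then show ?thesis
    proof cases
      case 1
      then obtain l r where lr: "\<And>i. i < k \<Longrightarrow> ((\<lambda>s. \<gamma>1 s i) \<longlongrightarrow> l i) (at_left (2 * t))"
        "\<And>i. i < k \<Longrightarrow> ((\<lambda>s. \<gamma>1 s i) \<longlongrightarrow> r i) (at_right (2 * t))"
        "tuple_span k l = tuple_span k (\<gamma>1 (2 * t))" "tuple_span k r = tuple_span k (\<gamma>1 (2 * t))"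
        using lim1 by metis
      have t: "t < 1/2" using 1 T1(2) by force
      then have near: "\<forall>\<^sub>F s in at t within S. s < 1/2" for S
        using order_tendstoD(2)[OF tendsto_ident_at] by blast
      have "((\<lambda>s. ?g s i) \<longlongrightarrow> l i) (at_left t)" if "i < k" for i
        using filterlim_compose[OF lr(1)[OF that]] filterlim_affine_at_left[of 2 0 t]
        by (intro half1 near) auto
      moreover have "((\<lambda>s. ?g s i) \<longlongrightarrow> r i) (at_right t)" if "i < k" for i
        using filterlim_compose[OF lr(2)[OF that]] filterlim_affine_at_right[of 2 0 t]
        by (intro half1 near) auto
      ultimately show ?thesis
        using lr(3,4) t by (intro exI[of _ l] exI[of _ r]) simp
    next
      case 2
      have "((\<lambda>s. ?g s i) \<longlongrightarrow> \<gamma>1 1 i) (at_left t)" if "i < k" for i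
      proof -
        \<comment> \<open>\<open>T1\<close> is finite and misses 1, so near 1 the set
          \<open>{0..1} - T1\<close> is just a left neighbourhood, and continuity at 1 yields the
          left limit.\<close>
        have "at 1 within ({0..1} - T1) = at_left (1::real)"
          using T1 by (intro at_within_nhd[of 1 "{0<..} - T1"])
            (auto intro: open_Diff finite_imp_closed)
        moreover have "1 \<notin> T1" using T1(2) by auto
        ultimately have "((\<lambda>s. \<gamma>1 s i) \<longlongrightarrow> \<gamma>1 1 i) (at_left 1)"
          using bspec[OF cont1[OF that, unfolded continuous_on_def], of 1] by simp
        moreover have "filterlim (\<lambda>s. 2 * s) (at_left 1) (at_left t)"
          using filterlim_affine_at_left[of 2 0 "1/2"] unfolding 2 by simp
        ultimately have "((\<lambda>s. \<gamma>1 (2 * s) i) \<longlongrightarrow> \<gamma>1 1 i) (at_left t)"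
          by (rule filterlim_compose)
        then show ?thesis
          by (rule half1) (auto simp: 2 eventually_at_filter)
      qed
      moreover have "((\<lambda>s. ?g s i) \<longlongrightarrow> \<gamma>2 0 i) (at_right t)" if "i < k" for i
      proof -
        have "at 0 within ({0..1} - T2) = at_right (0::real)"
          using T2 by (intro at_within_nhd[of 0 "{..<1} - T2"])
            (auto intro: open_Diff finite_imp_closed)
        moreover have "0 \<notin> T2" using T2(2) by auto
        ultimately have "((\<lambda>s. \<gamma>2 s i) \<longlongrightarrow> \<gamma>2 0 i) (at_right 0)"
          using bspec[OF cont2[OF that, unfolded continuous_on_def], of 0] by simp
        moreover have "filterlim (\<lambda>s. 2 * s - 1) (at_right 0) (at_right t)"
          using filterlim_affine_at_right[of 2 "-1" "1/2"] unfolding 2 by simp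
        ultimately have "((\<lambda>s. \<gamma>2 (2 * s - 1) i) \<longlongrightarrow> \<gamma>2 0 i) (at_right t)"
          by (rule filterlim_compose)
        then show ?thesis
          by (rule half2) (auto simp: 2 eventually_at_filter)
      qed
      ultimately show ?thesis
        using ends unfolding 2 by (intro exI[of _ "\<gamma>1 1"] exI[of _ "\<gamma>2 0"]) simp
    next
      case 3
      then obtain l r where lr: "\<And>i. i < k \<Longrightarrow> ((\<lambda>s. \<gamma>2 s i) \<longlongrightarrow> l i) (at_left (2 * t - 1))"
        "\<And>i. i < k \<Longrightarrow> ((\<lambda>s. \<gamma>2 s i) \<longlongrightarrow> r i) (at_right (2 * t - 1))"
        "tuple_span k l = tuple_span k (\<gamma>2 (2 * t - 1))"
        "tuple_span k r = tuple_span k (\<gamma>2 (2 * t - 1))"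
        using lim2 by metis
      have t: "t > 1/2" using 3 T2(2) by force
      then have near: "\<forall>\<^sub>F s in at t within S. s > 1/2" for S
        using order_tendstoD(1)[OF tendsto_ident_at] by blast
      have "((\<lambda>s. ?g s i) \<longlongrightarrow> l i) (at_left t)" if "i < k" for i
        using filterlim_compose[OF lr(1)[OF that]] filterlim_affine_at_left[of 2 "-1" t]
        by (intro half2 near) auto
      moreover have "((\<lambda>s. ?g s i) \<longlongrightarrow> r i) (at_right t)" if "i < k" for i
        using filterlim_compose[OF lr(2)[OF that]] filterlim_affine_at_right[of 2 "-1" t]
        by (intro half2 near) auto
      ultimately show ?thesis
        using lr(3,4) t by (intro exI[of _ l] exI[of _ r]) simp
    qed
  qed
  show ?thesis
    unfolding subspace_path_def
  proof (intro conjI exI[of _ T])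
    show "\<forall>t\<in>{0..1}. lin_indep_tuple k (?g t)"
      using ind1 ind2 by auto
  qed (use ends finT subT cont jumps in auto)
qed

section \<open>Finite families of planes and generic paths\<close>

text \<open>The planes will be the direction spaces of the 2-faces. As \<open>Ls\<close> is a set,
  parallel faces contribute one plane, so planes stand for parallel classes.\<close>

locale plane_family =
  fixes Ls :: "'a::euclidean_space set set"
  assumes dim_ge_3: "DIM('a) \<ge> 3"
    and finite_planes: "finite Ls"
    and subspace_plane: "L \<in> Ls \<Longrightarrow> subspace L"
    and dim_plane: "L \<in> Ls \<Longrightarrow> dim L = 2"
begin

text \<open>For a subspace of codimension two this is admissibility as an orthogonal, stated without
  projections.\<close>

definition transverse :: "'a set \<Rightarrow> bool" where
  "transverse V \<longleftrightarrow> (\<forall>L\<in>Ls. V \<inter> L = {0})"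

text \<open>The last clause gives uniqueness of the degenerating plane; its existence at an
  exceptional time is the failure of transversality itself.\<close>

definition generic_path :: "'a set \<Rightarrow> 'a set \<Rightarrow> (real \<Rightarrow> nat \<Rightarrow> 'a) \<Rightarrow> bool" where
  "generic_path V V' \<gamma> \<longleftrightarrow> subspace_path (DIM('a) - 2) V V' \<gamma> \<and>
     finite {t \<in> {0..1}. \<not> transverse (tuple_span (DIM('a) - 2) (\<gamma> t))} \<and>
     (\<forall>t\<in>{0..1}. \<forall>L\<in>Ls. \<forall>M\<in>Ls.
        tuple_span (DIM('a) - 2) (\<gamma> t) \<inter> L \<noteq> {0} \<longrightarrow>
        tuple_span (DIM('a) - 2) (\<gamma> t) \<inter> M \<noteq> {0} \<longrightarrow> L = M)"

definition connected_by_path :: "'a set \<Rightarrow> 'a set \<Rightarrow> bool" where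
  "connected_by_path V V' \<longleftrightarrow> (\<exists>\<gamma>. generic_path V V' \<gamma>)"

lemma connected_by_path_trans:
  assumes "connected_by_path A B" "connected_by_path B C"
  shows "connected_by_path A C"
proof -
  let ?k = "DIM('a) - 2"
  obtain \<gamma>1 \<gamma>2 where g: "generic_path A B \<gamma>1" "generic_path B C \<gamma>2"
    using assms by (auto simp: connected_by_path_def)
  let ?g = "\<lambda>t. if t \<le> 1/2 then \<gamma>1 (2 * t) else \<gamma>2 (2 * t - 1)"
  let ?N = "\<lambda>\<gamma>. {t \<in> {0..1::real}. \<not> transverse (tuple_span ?k (\<gamma> t))}"
  have fin: "finite (?N \<gamma>1)" "finite (?N \<gamma>2)"
    using g by (auto simp: generic_path_def)
  have "?N ?g \<subseteq> (\<lambda>t. t / 2) ` ?N \<gamma>1 \<union> (\<lambda>t. (t + 1) / 2) ` ?N \<gamma>2"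
  proof
    fix t assume t: "t \<in> ?N ?g"
    show "t \<in> (\<lambda>t. t / 2) ` ?N \<gamma>1 \<union> (\<lambda>t. (t + 1) / 2) ` ?N \<gamma>2"
    proof (cases "t \<le> 1/2")
      case True
      then have "2 * t \<in> ?N \<gamma>1" using t by auto
      then show ?thesis by (intro UnI1 image_eqI[of _ _ "2 * t"]) auto
    next
      case False
      then have "2 * t - 1 \<in> ?N \<gamma>2" using t by auto
      then show ?thesis by (intro UnI2 image_eqI[of _ _ "2 * t - 1"]) auto
    qed
  qed
  then have "finite (?N ?g)"
    using fin by (meson finite_Un finite_imageI finite_subset)
  moreover have "\<forall>t\<in>{0..1}. \<forall>L\<in>Ls. \<forall>M\<in>Ls. tuple_span ?k (?g t) \<inter> L \<noteq> {0} \<longrightarrow>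
        tuple_span ?k (?g t) \<inter> M \<noteq> {0} \<longrightarrow> L = M"
  proof
    fix t :: real assume t: "t \<in> {0..1}"
    show "\<forall>L\<in>Ls. \<forall>M\<in>Ls. tuple_span ?k (?g t) \<inter> L \<noteq> {0} \<longrightarrow>
        tuple_span ?k (?g t) \<inter> M \<noteq> {0} \<longrightarrow> L = M"
    proof (cases "t \<le> 1/2")
      case True
      then have "2 * t \<in> {0..1}" using t by auto
      then show ?thesis using g(1) True unfolding generic_path_def by (simp only: if_True) blast
    next
      case False
      then have "2 * t - 1 \<in> {0..1}" using t by auto
      then show ?thesis using g(2) False unfolding generic_path_def by (simp only: if_False) blast
    qed
  qed
  moreover have "subspace_path ?k A C ?g"
    using g by (intro subspace_path_join) (auto simp: generic_path_def)
  ultimately have "generic_path A C ?g"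
    unfolding generic_path_def by (intro conjI)
  then show ?thesis by (auto simp: connected_by_path_def)
qed

text \<open>The last condition keeps \<open>U + L\<close> and \<open>U + M\<close> distinct, so that the positions of a moving
  vector at which \<open>L\<close> and \<open>M\<close> degenerate simultaneously have codimension two.\<close>

definition separating :: "'a set \<Rightarrow> bool" where
  "separating U \<longleftrightarrow> subspace U \<and> transverse U \<and>
     (\<forall>L\<in>Ls. \<forall>M\<in>Ls. L \<noteq> M \<longrightarrow> \<not> M \<subseteq> span (U \<union> L))"

section \<open>Separating subspaces and their generic extensions\<close>

lemma dim_Un_plane:
  assumes "subspace U" "L \<in> Ls"
  shows "dim (U \<union> L) \<le> dim U + 2"
  using dim_subspace_Un_Int[OF assms(1) subspace_plane[OF assms(2)]] dim_plane[OF assms(2)] by simp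

lemma transverse_mono:
  assumes "transverse U" "subspace T" "T \<subseteq> U"
  shows "transverse T"
  unfolding transverse_def
proof
  fix L assume L: "L \<in> Ls"
  then have "U \<inter> L = {0}" using assms(1) by (simp add: transverse_def)
  moreover have "0 \<in> T \<inter> L"
    using assms(2) L subspace_0 subspace_plane by blast
  ultimately show "T \<inter> L = {0}" using assms(3) by blast
qed

lemma separating_mono:
  assumes "separating U" "subspace T" "T \<subseteq> U"
  shows "separating T"
proof -
  have "span (T \<union> L) \<subseteq> span (U \<union> L)" for L
    using assms(3) by (intro span_mono) auto
  then show ?thesis
    using assms transverse_mono unfolding separating_def by (meson order_trans)
qed

text \<open>For \<open>x\<close> outside \<open>U\<close>, a nonzero vector of \<open>L\<close> in
  \<open>span (insert x U)\<close> is outside \<open>U\<close> and can be exchanged for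
  \<open>x\<close>; conversely \<open>x = u + l\<close> gives \<open>l = x - u\<close>. Degeneracy
  thus becomes membership of the moving vector in a fixed subspace.\<close>

lemma insert_meets_plane_iff:
  assumes "subspace U" "transverse U" "L \<in> Ls"
  shows "span (insert x U) \<inter> L = {0} \<longleftrightarrow> x \<notin> span (U \<union> L) \<or> x \<in> U"
proof -
  have U0: "U \<inter> L = {0}"
    using assms by (auto simp: transverse_def)
  have spU: "span U = U" and spL: "span L = L"
    using assms subspace_plane by (auto simp: span_of_subspace)
  show ?thesis
  proof (cases "x \<in> U")
    case True
    then have "span (insert x U) = U" by (simp add: insert_absorb spU)
    with U0 True show ?thesis by simp
  next
    case x: False
    have "span (insert x U) \<inter> L \<noteq> {0} \<longleftrightarrow> x \<in> span (U \<union> L)"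
    proof
      assume "span (insert x U) \<inter> L \<noteq> {0}"
      moreover have "0 \<in> span (insert x U) \<inter> L"
        using subspace_0[OF subspace_plane[OF assms(3)]] by (simp add: span_zero)
      ultimately obtain y where y: "y \<in> span (insert x U)" "y \<in> L" "y \<noteq> 0" by auto
      then have "y \<notin> span U" using U0 unfolding spU by blast
      then have "x \<in> span (insert y U)" using y(1) in_span_insert by blast
      then show "x \<in> span (U \<union> L)"
        using y(2) span_mono[of "insert y U" "U \<union> L"] by auto
    next
      assume "x \<in> span (U \<union> L)"
      then obtain u l where ul: "u \<in> U" "l \<in> L" "x = u + l"
        by (auto simp: span_Un spU spL)
      then have "l = x - u" by simp
      then have "l \<in> span (insert x U)"
        using ul(1) by (auto intro!: span_diff intro: span_base)
      moreover have "l \<noteq> 0" using ul x by auto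
      ultimately show "span (insert x U) \<inter> L \<noteq> {0}" using ul(2) by blast
    qed
    with x show ?thesis by blast
  qed
qed

text \<open>The bad vectors \<open>g\<close> lie in finitely many subspaces of dimension at most
  \<open>dim T + 3\<close>. The family itself is handed out so that one choice of \<open>g\<close>
  can avoid it together with other subspaces.\<close>

lemma separating_insert:
  assumes T: "separating T" "dim T + 4 \<le> DIM('a)"
  obtains \<A> where "finite \<A>" "\<And>A. A \<in> \<A> \<Longrightarrow> dim A < DIM('a)"
    "\<And>g. (\<And>A. A \<in> \<A> \<Longrightarrow> g \<notin> A) \<Longrightarrow> separating (span (insert g T))"
proof -
  have subT: "subspace T" and trT: "transverse T"
    using T by (auto simp: separating_def)
  have "\<exists>m. m \<in> M \<and> m \<notin> span (T \<union> L)" if "L \<in> Ls" "M \<in> Ls" "L \<noteq> M" for L M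
    using T that by (auto simp: separating_def)
  \<comment> \<open>With a fixed witness \<open>m L M\<close> it suffices to keep a single vector
    out of the enlarged sum, which by exchange is a subspace condition on \<open>g\<close>.\<close>
  then obtain m where m: "\<And>L M. L \<in> Ls \<Longrightarrow> M \<in> Ls \<Longrightarrow> L \<noteq> M \<Longrightarrow> m L M \<in> M \<and> m L M \<notin> span (T \<union> L)"
    by metis
  let ?\<A> = "(\<lambda>L. span (T \<union> L)) ` Ls \<union> (\<lambda>(L, M). span (insert (m L M) (T \<union> L))) ` (Ls \<times> Ls)"
  show thesis
  proof
    show "finite ?\<A>" using finite_planes by auto
    have dim: "dim (insert y (T \<union> L)) \<le> dim T + 3" if "L \<in> Ls" for y L
      using dim_Un_plane[OF subT that] by (simp add: dim_insert)
    show "dim A < DIM('a)" if "A \<in> ?\<A>" for A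
    proof -
      from that consider L where "L \<in> Ls" "A = span (T \<union> L)"
        | L y where "L \<in> Ls" "A = span (insert y (T \<union> L))" by auto
      then show ?thesis
      proof cases
        case 1
        then show ?thesis using dim_Un_plane[OF subT, of L] T(2) by simp
      next
        case 2
        then show ?thesis using dim[of L y] T(2) by simp
      qed
    qed
    fix g assume g: "\<And>A. A \<in> ?\<A> \<Longrightarrow> g \<notin> A"
    have g1: "g \<notin> span (T \<union> L)" if "L \<in> Ls" for L
      using g that by blast
    have g2: "g \<notin> span (insert (m L M) (T \<union> L))" if "L \<in> Ls" "M \<in> Ls" for L M
      using g that by blast
    have "\<not> M \<subseteq> span (span (insert g T) \<union> L)" if LM: "L \<in> Ls" "M \<in> Ls" "L \<noteq> M" for L M
    proof
      assume "M \<subseteq> span (span (insert g T) \<union> L)"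
      also have "\<dots> = span (insert g (T \<union> L))"
        by (simp add: span_Un span_span flip: Un_insert_left)
      finally have "m L M \<in> span (insert g (T \<union> L))" using m[OF LM] by blast
      then have "g \<in> span (insert (m L M) (T \<union> L))"
        using m[OF LM] in_span_insert by blast
      then show False using g2 LM by blast
    qed
    moreover have "transverse (span (insert g T))"
      using g1 insert_meets_plane_iff[OF subT trT] by (auto simp: transverse_def)
    ultimately show "separating (span (insert g T))"
      by (simp add: separating_def)
  qed
qed

section \<open>Connecting subspaces by exchanging one basis vector\<close>

text \<open>As \<open>x\<close> lies off each hyperplane \<open>span (U \<union> L)\<close>, the
  line through \<open>x\<close> and \<open>z\<close> meets it at most once. It misses the
  intersection of two of them because \<open>z\<close> avoids the span of that intersection and
  \<open>x\<close>.\<close>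

lemma segment_connected:
  assumes U: "separating U" "dim U + 3 = DIM('a)"
    and x: "x \<notin> U" and xL: "\<And>L. L \<in> Ls \<Longrightarrow> x \<notin> span (U \<union> L)"
    and zU: "z \<notin> span (insert x U)" and zL: "\<And>L. L \<in> Ls \<Longrightarrow> z \<notin> span (U \<union> L)"
    and zLM: "\<And>L M. L \<in> Ls \<Longrightarrow> M \<in> Ls \<Longrightarrow> L \<noteq> M \<Longrightarrow> z \<notin> span (insert x (span (U \<union> L) \<inter> span (U \<union> M)))"
  shows "connected_by_path (span (insert x U)) (span (insert z U))"
proof -
  let ?k = "DIM('a) - 2"
  let ?n = "DIM('a) - 3"
  define p where "p t = (1 - t) *\<^sub>R x + t *\<^sub>R z" for t :: real
  have k: "?k = Suc ?n" using U(2) by simp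
  have subU: "subspace U" and trU: "transverse U"
    using U by (auto simp: separating_def)
  \<comment> \<open>A point of the line in \<open>S\<close> with nonzero \<open>t\<close> would
    express \<open>z\<close> through \<open>S\<close> and \<open>x\<close>. This is used with
    \<open>U\<close> for independence and with the intersection of two hyperplanes for
    uniqueness.\<close>
  have p_notin: "p t \<notin> S" if S: "subspace S" "x \<notin> S" "z \<notin> span (insert x S)" for t S
  proof
    assume pS: "p t \<in> S"
    show False
    proof (cases "t = 0")
      case True
      with pS S(2) show False by (simp add: p_def)
    next
      case False
      have "t *\<^sub>R z = p t - (1 - t) *\<^sub>R x" by (simp add: p_def)
      also have "\<dots> \<in> span (insert x S)"
        using pS by (intro span_diff span_scale) (auto intro: span_base)
      finally have "(1 / t) *\<^sub>R t *\<^sub>R z \<in> span (insert x S)" by (rule span_scale)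
      with False S(3) show False by simp
    qed
  qed
  have pU: "p t \<notin> U" for t
    using p_notin[OF subU x zU] .
  obtain B where B: "B \<subseteq> U" "independent B" "U \<subseteq> span B" "card B = dim U"
    using basis_exists by blast
  have spB: "span B = U" using B subU span_subspace by blast
  have "finite B" using B independent_imp_finite by blast
  then obtain h where h: "bij_betw h {..<?n} B"
    using ex_bij_betw_nat_finite[of B] B(4) U(2) by (metis add_diff_cancel_right' lessThan_atLeast0)
  \<comment> \<open>The indices below \<open>?n\<close> carry a fixed basis of \<open>U\<close>, the
    last one the moving vector.\<close>
  define \<gamma> where "\<gamma> t i = (if i = ?n then p t else h i)" for t :: real and i
  have "\<gamma> t ` {..<?n} = h ` {..<?n}" for t by (auto simp: \<gamma>_def)
  then have im: "\<gamma> t ` {..<?k} = insert (p t) B" for t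
    using h by (simp add: k lessThan_Suc bij_betw_def) (simp add: \<gamma>_def)
  have tsp: "tuple_span ?k (\<gamma> t) = span (insert (p t) U)" for t
    unfolding tuple_span_def im span_insert spB span_of_subspace[OF subU] ..
  have ind: "lin_indep_tuple ?k (\<gamma> t)" for t
    unfolding lin_indep_tuple_def
  proof
    show "independent (\<gamma> t ` {..<?k})"
      unfolding im using B pU spB by (simp add: independent_insert)
    have "card (\<gamma> t ` {..<?k}) = ?k"
      unfolding im using \<open>finite B\<close> B(1,4) pU U(2) by (subst card_insert_disjoint) auto
    then show "inj_on (\<gamma> t) {..<?k}"
      by (intro eq_card_imp_inj_on) auto
  qed
  have meets: "span (insert (p t) U) \<inter> L = {0} \<longleftrightarrow> p t \<notin> span (U \<union> L)" if "L \<in> Ls" for t L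
    using insert_meets_plane_iff[OF subU trU that] pU by simp
  have "subspace_path ?k (span (insert x U)) (span (insert z U)) \<gamma>"
    unfolding subspace_path_def
  proof (intro conjI exI[of _ "{}"] ballI allI impI)
    fix i
    show "continuous_on ({0..1} - {}) (\<lambda>t. \<gamma> t i)"
      unfolding \<gamma>_def p_def by (cases "i = ?n") (auto intro!: continuous_intros)
  qed (use ind tsp in \<open>auto simp: p_def\<close>)
  moreover have "finite {t \<in> {0..1}. \<not> transverse (tuple_span ?k (\<gamma> t))}"
  proof -
    have "finite {t. p t \<in> span (U \<union> L)}" if L: "L \<in> Ls" for L
    proof -
      have "s = t" if st: "p s \<in> span (U \<union> L)" "p t \<in> span (U \<union> L)" for s t
      proof (rule ccontr)
        assume "s \<noteq> t"
        \<comment> \<open>This combination cancels \<open>z\<close>, so two hits of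
          \<open>span (U \<union> L)\<close> would force \<open>x\<close> into it.\<close>
        have "(s - t) *\<^sub>R x = s *\<^sub>R p t - t *\<^sub>R p s"
          by (simp add: p_def algebra_simps)
        also have "\<dots> \<in> span (U \<union> L)"
          using st by (intro span_diff span_scale)
        finally have "(1 / (s - t)) *\<^sub>R (s - t) *\<^sub>R x \<in> span (U \<union> L)" by (rule span_scale)
        with \<open>s \<noteq> t\<close> xL[OF L] show False by simp
      qed
      then show ?thesis
        by (cases "{t. p t \<in> span (U \<union> L)} = {}") (auto intro: finite_subset[of _ "{_}"])
    qed
    then have "finite (\<Union>L\<in>Ls. {t. p t \<in> span (U \<union> L)})"
      using finite_planes by blast
    then show ?thesis
      by (rule rev_finite_subset) (auto simp: tsp transverse_def meets)
  qed
  moreover have "L = M" if "L \<in> Ls" "M \<in> Ls" "tuple_span ?k (\<gamma> t) \<inter> L \<noteq> {0}"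
    "tuple_span ?k (\<gamma> t) \<inter> M \<noteq> {0}" for t L M
  proof (rule ccontr)
    assume "L \<noteq> M"
    have "p t \<in> span (U \<union> L) \<inter> span (U \<union> M)"
      using that tsp meets by auto
    then show False
      using p_notin[OF subspace_inter[OF subspace_span subspace_span] _ zLM[OF that(1,2) \<open>L \<noteq> M\<close>]]
        xL[OF that(1)] by blast
  qed
  ultimately have "generic_path (span (insert x U)) (span (insert z U)) \<gamma>"
    by (auto simp: generic_path_def)
  then show ?thesis by (auto simp: connected_by_path_def)
qed

text \<open>The direct segment from \<open>x\<close> to \<open>y\<close> may run through an
  intersection of two hyperplanes, hence the detour over a generic \<open>z\<close>.\<close>

lemma connected_if_share:
  assumes U: "separating U" "dim U + 3 = DIM('a)"
    and x: "x \<notin> U" "transverse (span (insert x U))"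
    and y: "y \<notin> U" "transverse (span (insert y U))"
  shows "connected_by_path (span (insert x U)) (span (insert y U))"
proof -
  have subU: "subspace U" and trU: "transverse U"
    using U by (auto simp: separating_def)
  let ?I = "\<lambda>L M. span (U \<union> L) \<inter> span (U \<union> M)"
  let ?P = "{(L, M) \<in> Ls \<times> Ls. L \<noteq> M}"
  \<comment> \<open>Avoiding the three families makes \<open>z\<close> independent over
    \<open>U\<close> of \<open>x\<close> and of \<open>y\<close>, keeps
    \<open>span (insert z U)\<close> transverse, and keeps both segments off the pairwise
    intersections of the hyperplanes.\<close>
  let ?\<A> = "(\<lambda>w. span (insert w U)) ` {x, y} \<union> (\<lambda>L. span (U \<union> L)) ` Ls \<union>
    (\<lambda>(w, L, M). span (insert w (?I L M))) ` ({x, y} \<times> ?P)"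
  have "finite ?P" by (rule finite_subset[of _ "Ls \<times> Ls"]) (use finite_planes in auto)
  then have "finite ?\<A>" using finite_planes by simp
  moreover have "dim A < DIM('a)" if "A \<in> ?\<A>" for A
  proof -
    from that consider w where "A = span (insert w U)" | L where "L \<in> Ls" "A = span (U \<union> L)"
      | w L M where "L \<in> Ls" "M \<in> Ls" "L \<noteq> M" "A = span (insert w (?I L M))" by blast
    then show ?thesis
    proof cases
      case 1
      then show ?thesis using U(2) by (simp add: dim_insert)
    next
      case 2
      then show ?thesis using dim_Un_plane[OF subU] U(2) by fastforce
    next
      case 3
      \<comment> \<open>Separation makes the intersection proper in
        \<open>span (U \<union> M)\<close>, so its dimension is at most \<open>dim U + 1\<close>,
        and adding \<open>w\<close> still leaves a proper subspace.\<close>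
      have "\<not> M \<subseteq> span (U \<union> L)" using 3 U by (auto simp: separating_def)
      then have "?I L M \<subset> span (U \<union> M)" by (auto intro: span_base)
      then have "dim (?I L M) < dim (span (U \<union> M))"
        by (intro dim_psubset) (simp add: span_of_subspace subspace_inter)
      also have "\<dots> \<le> dim U + 2" using dim_Un_plane[OF subU] 3 by simp
      finally show ?thesis using U(2) 3 by (simp add: dim_insert)
    qed
  qed
  ultimately have "\<exists>z. \<forall>A\<in>?\<A>. z \<notin> A"
    by (rule avoid_proper_subspaces)
  then obtain z where "\<forall>A\<in>?\<A>. z \<notin> A" ..
  note z = bspec[OF this]
  have zw: "z \<notin> span (insert w U)" if "w \<in> {x, y}" for w
    by (rule z[OF UnI1[OF UnI1[OF imageI[OF that]]]])
  have zL: "z \<notin> span (U \<union> L)" if "L \<in> Ls" for L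
    by (rule z[OF UnI1[OF UnI2[OF imageI[OF that]]]])
  have zLM: "z \<notin> span (insert w (?I L M))" if "w \<in> {x, y}" "L \<in> Ls" "M \<in> Ls" "L \<noteq> M" for w L M
    using z[OF UnI2[OF imageI[of "(w, L, M)"]]] that by simp
  have wL: "w \<notin> span (U \<union> L)" if "w \<in> {x, y}" "L \<in> Ls" for w L
    using that insert_meets_plane_iff[OF subU trU] x y by (auto simp: transverse_def)
  have spI: "span (?I L M) = ?I L M" for L M
    by (simp add: span_of_subspace subspace_inter)
  have "connected_by_path (span (insert x U)) (span (insert z U))"
    by (rule segment_connected[OF U x(1)]) (use wL zw zL zLM in blast)+
  \<comment> \<open>This segment starts at \<open>z\<close>, so the exchange property is used to
    swap the roles of \<open>y\<close> and \<open>z\<close> in the conditions.\<close>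
  moreover have "connected_by_path (span (insert z U)) (span (insert y U))"
  proof (rule segment_connected[OF U])
    have zy: "z \<notin> span (insert y U)" by (rule zw) simp
    then show "z \<notin> U" using span_superset[of "insert y U"] by blast
    have "y \<notin> span U" unfolding span_of_subspace[OF subU] by (rule y(1))
    then show "y \<notin> span (insert z U)" using in_span_insert zy by blast
    fix L M assume LM: "L \<in> Ls" "M \<in> Ls" "L \<noteq> M"
    have "y \<notin> span (?I L M)" unfolding spI using wL[of y L] LM(1) by simp
    moreover have "z \<notin> span (insert y (?I L M))" by (rule zLM[OF _ LM]) simp
    ultimately show "y \<notin> span (insert z (?I L M))" using in_span_insert by blast
  qed (use zL wL in blast)+
  ultimately show ?thesis by (rule connected_by_path_trans)
qed

text \<open>Exchanging a suitable vector of \<open>U\<close> and one of \<open>U'\<close> for the same generic vector \<open>g\<close>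
  enlarges \<open>U \<inter> U'\<close>, which is the induction measure.\<close>

lemma connected_if_separating:
  assumes "separating U" "dim U + 3 = DIM('a)" "separating U'" "dim U' + 3 = DIM('a)"
    and "x \<notin> U" "transverse (span (insert x U))"
    and "x' \<notin> U'" "transverse (span (insert x' U'))"
  shows "connected_by_path (span (insert x U)) (span (insert x' U'))"
  using assms
proof (induction "dim U - dim (U \<inter> U')" arbitrary: U U' x x' rule: less_induct)
  case less
  have sub: "subspace U" "subspace U'" and tr: "transverse U" "transverse U'"
    using less.prems by (auto simp: separating_def)
  let ?I = "U \<inter> U'"
  have subI: "subspace ?I" using sub subspace_inter by blast
  show ?case
  proof (cases "U = U'")
    case True
    then show ?thesis using connected_if_share less.prems by blast
  next
    case False
    \<comment> \<open>The witness is the orthogonal complement inside \<open>S\<close> of a nonzero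
      \<open>n\<close> in \<open>S\<close> perpendicular to \<open>?I\<close>. It makes room for
      \<open>g\<close> without losing any of \<open>?I\<close>.\<close>
    have hyper: "\<exists>T. subspace T \<and> ?I \<subseteq> T \<and> T \<subseteq> S \<and> dim T + 1 = dim S"
      if S: "subspace S" "?I \<subseteq> S" "?I \<noteq> S" for S
    proof -
      have "span ?I \<subset> span S" using S subI by (simp add: span_of_subspace psubset_eq)
      then obtain n where n: "n \<noteq> 0" "n \<in> span S" "\<And>y. y \<in> span ?I \<Longrightarrow> orthogonal n y"
        using orthogonal_to_subspace_exists_gen by blast
      let ?T = "{y \<in> S. \<forall>v\<in>span {n}. orthogonal v y}"
      have nS: "n \<in> S" using n(2) span_of_subspace[OF S(1)] by simp
      have "dim ?T + dim (span {n}) = dim S"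
        using nS S(1) by (intro dim_subspace_orthogonal_to_vectors span_minimal) auto
      moreover have "dim (span {n}) = 1" using n(1) by simp
      moreover have "subspace ?T"
        using S(1) by (auto simp: subspace_def orthogonal_clauses)
      moreover have "?I \<subseteq> ?T"
        using n(3) S(2) by (force simp: span_singleton orthogonal_clauses intro: span_base)
      ultimately show ?thesis by (intro exI[of _ ?T]) auto
    qed
    have "\<not> U \<subseteq> U'" "\<not> U' \<subseteq> U"
      using False less.prems(2,4) subspace_dim_equal[OF sub] subspace_dim_equal[OF sub(2,1)] by auto
    then have neq: "?I \<noteq> U" "?I \<noteq> U'" by blast+
    obtain T where T: "subspace T" "?I \<subseteq> T" "T \<subseteq> U" "dim T + 1 = dim U"
      using hyper[of U] neq sub by auto
    obtain T' where T': "subspace T'" "?I \<subseteq> T'" "T' \<subseteq> U'" "dim T' + 1 = dim U'"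
      using hyper[of U'] neq sub by auto
    have sT: "separating T" and sT': "separating T'"
      using separating_mono less.prems T T' by blast+
    obtain \<A> where \<A>: "finite \<A>" "\<And>A. A \<in> \<A> \<Longrightarrow> dim A < DIM('a)"
      "\<And>g. (\<And>A. A \<in> \<A> \<Longrightarrow> g \<notin> A) \<Longrightarrow> separating (span (insert g T))"
      using separating_insert[OF sT] T less.prems by auto
    obtain \<A>' where \<A>': "finite \<A>'" "\<And>A. A \<in> \<A>' \<Longrightarrow> dim A < DIM('a)"
      "\<And>g. (\<And>A. A \<in> \<A>' \<Longrightarrow> g \<notin> A) \<Longrightarrow> separating (span (insert g T'))"
      using separating_insert[OF sT'] T' less.prems by auto
    \<comment> \<open>Avoiding these sums keeps \<open>span (insert g U)\<close> and
      \<open>span (insert g U')\<close> transverse.\<close>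
    let ?H = "(\<lambda>L. span (U \<union> L)) ` Ls \<union> (\<lambda>L. span (U' \<union> L)) ` Ls"
    have "finite (\<A> \<union> \<A>' \<union> ?H \<union> {U, U'})"
      using \<A> \<A>' finite_planes by auto
    moreover have "dim A < DIM('a)" if "A \<in> \<A> \<union> \<A>' \<union> ?H \<union> {U, U'}" for A
    proof -
      from that consider "A \<in> \<A> \<union> \<A>'" | L where "L \<in> Ls" "A = span (U \<union> L)"
        | L where "L \<in> Ls" "A = span (U' \<union> L)" | "A \<in> {U, U'}" by auto
      then show ?thesis
      proof cases
        case 1
        then show ?thesis using \<A>(2) \<A>'(2) by blast
      next
        case 2
        then show ?thesis using dim_Un_plane[OF sub(1)] less.prems(2) by fastforce
      next
        case 3
        then show ?thesis using dim_Un_plane[OF sub(2)] less.prems(4) by fastforce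
      next
        case 4
        then show ?thesis using less.prems(2,4) by auto
      qed
    qed
    ultimately have "\<exists>g. \<forall>A\<in>\<A> \<union> \<A>' \<union> ?H \<union> {U, U'}. g \<notin> A"
      by (rule avoid_proper_subspaces)
    then obtain g where "\<forall>A\<in>\<A> \<union> \<A>' \<union> ?H \<union> {U, U'}. g \<notin> A" ..
    note g = bspec[OF this]
    have gU: "g \<notin> U" "g \<notin> U'" using g[of U] g[of U'] by simp_all
    have gL: "g \<notin> span (U \<union> L)" "g \<notin> span (U' \<union> L)" if "L \<in> Ls" for L
      by (rule g[OF UnI1[OF UnI2[OF UnI1[OF imageI[OF that]]]]],
          rule g[OF UnI1[OF UnI2[OF UnI2[OF imageI[OF that]]]]])
    have trg: "transverse (span (insert g U))" "transverse (span (insert g U'))"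
      using gL insert_meets_plane_iff[OF sub(1) tr(1)] insert_meets_plane_iff[OF sub(2) tr(2)]
      by (auto simp: transverse_def)
    have sW: "separating (span (insert g T))" and sW': "separating (span (insert g T'))"
      by (rule \<A>(3), rule g, simp) (rule \<A>'(3), rule g, simp)
    have gT: "g \<notin> T" "g \<notin> T'" using gU T T' by auto
    have dW: "dim (span (insert g T)) + 3 = DIM('a)" "dim (span (insert g T')) + 3 = DIM('a)"
      using dim_insert_subspace[OF T(1) gT(1)] dim_insert_subspace[OF T'(1) gT(2)]
        T(4) T'(4) less.prems(2,4) by linarith+
    \<comment> \<open>Inserting \<open>g\<close> into \<open>S\<close> restores the dimension of
      \<open>V\<close>, so one vector \<open>w\<close> completes it to
      \<open>span (insert g V)\<close>. The same space is thus an extension of \<open>V\<close> by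
      \<open>g\<close> and of the new separating space by \<open>w\<close>.\<close>
    have split: "\<exists>w. w \<notin> span (insert g S) \<and> span (insert g V) = span (insert w (span (insert g S)))"
      if SV: "subspace S" "S \<subseteq> V" "dim S + 1 = dim V" "subspace V" "g \<notin> V" for S V
    proof -
      have "dim (span (insert g S)) < dim (span (insert g V))"
        using SV dim_insert_subspace by (metis add_less_cancel_right less_add_one subset_iff)
      then have "\<not> insert g V \<subseteq> span (insert g S)"
        by (metis dim_span leD dim_subset span_minimal subspace_span)
      then obtain w where w: "w \<in> insert g V" "w \<notin> span (insert g S)" by blast
      have "span (insert w (span (insert g S))) = span (insert g V)"
      proof (rule subspace_dim_equal)
        show "span (insert w (span (insert g S))) \<subseteq> span (insert g V)"
          using w SV(2) span_mono[of "insert g S" "insert g V"]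
          by (intro span_minimal) (auto intro: span_base)
        show "dim (span (insert g V)) \<le> dim (span (insert w (span (insert g S))))"
          using dim_insert_subspace[OF subspace_span w(2)] dim_insert_subspace SV
          by (metis order_refl subset_iff)
      qed auto
      with w show ?thesis by auto
    qed
    obtain w where w: "w \<notin> span (insert g T)"
      "span (insert g U) = span (insert w (span (insert g T)))"
      using split[of T U] T sub gU by blast
    obtain w' where w': "w' \<notin> span (insert g T')"
      "span (insert g U') = span (insert w' (span (insert g T')))"
      using split[of T' U'] T' sub gU by blast
    \<comment> \<open>\<open>g\<close> lies in both new spaces but not in \<open>?I\<close>, so the
      common part grows while the dimension stays that of \<open>U\<close>.\<close>
    have "dim ?I + 1 = dim (span (insert g ?I))"
      using dim_insert_subspace[OF subI] gU by simp
    also have "\<dots> \<le> dim (span (insert g T) \<inter> span (insert g T'))"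
      using T(2) T'(2) by (intro dim_subset Int_greatest span_mono) auto
    finally have big: "dim ?I + 1 \<le> dim (span (insert g T) \<inter> span (insert g T'))" .
    \<comment> \<open>The measure is a truncated difference; it is positive here, so its decrease is
      strict.\<close>
    have "dim ?I < dim U"
      using neq(1) sub(1) subI by (intro dim_psubset) (auto simp: span_of_subspace)
    then have "dim (span (insert g T)) - dim (span (insert g T) \<inter> span (insert g T')) < dim U - dim ?I"
      using big dW(1) less.prems(2) by linarith
    \<comment> \<open>The middle link is the induction hypothesis; the outer two only change the
      vector added to \<open>U\<close> or to \<open>U'\<close>.\<close>
    then have "connected_by_path (span (insert g U)) (span (insert g U'))"
      using less.hyps[of "span (insert g T)" "span (insert g T')" w w'] sW sW' dW w w' trg by metis
    moreover have "connected_by_path (span (insert x U)) (span (insert g U))"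
      using connected_if_share less.prems gU trg by blast
    moreover have "connected_by_path (span (insert g U')) (span (insert x' U'))"
      using connected_if_share less.prems gU trg by blast
    ultimately show ?thesis using connected_by_path_trans by blast
  qed
qed

section \<open>Separating subspaces inside transverse ones\<close>

text \<open>\<open>V\<close> and \<open>L\<close> are complementary, so a vector of \<open>M\<close>
  outside \<open>L\<close> has a nonzero component \<open>v\<close> in \<open>V\<close>, and
  \<open>M\<close> leaves \<open>span (U \<union> L)\<close> once \<open>v\<close> is not in
  \<open>U\<close>. Cutting \<open>V\<close> by the hyperplane orthogonal to a generic
  \<open>n\<close> drops all these \<open>v\<close> at once.\<close>

lemma transverse_has_separating:
  assumes V: "subspace V" "dim V + 2 = DIM('a)" "transverse V"
  obtains U x where "separating U" "dim U + 3 = DIM('a)" "x \<notin> U" "V = span (insert x U)"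
proof -
  let ?P = "{(L, M) \<in> Ls \<times> Ls. L \<noteq> M}"
  have "\<exists>v. v \<in> V \<and> v \<noteq> 0 \<and> (\<exists>l\<in>L. v + l \<in> M)"
    if LM: "L \<in> Ls" "M \<in> Ls" "L \<noteq> M" for L M
  proof -
    have "\<not> M \<subseteq> L"
      using subspace_dim_equal[of M L] LM subspace_plane dim_plane by auto
    then obtain m where m: "m \<in> M" "m \<notin> L" by blast
    have "dim (V \<union> L) + dim (V \<inter> L) = DIM('a)"
      using dim_subspace_Un_Int[OF V(1) subspace_plane] V(2) dim_plane LM by simp
    moreover have "V \<inter> L = {0}" using V LM by (auto simp: transverse_def)
    ultimately have "span (V \<union> L) = UNIV" by (simp add: dim_eq_full)
    then have "m \<in> span (V \<union> L)" by simp
    then obtain v l where "v \<in> V" "l \<in> L" "m = v + l"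
      using V(1) subspace_plane[OF LM(1)] by (auto simp: span_Un span_of_subspace)
    with m show ?thesis by (intro exI[of _ v]) auto
  qed
  then obtain v where v: "\<And>L M. L \<in> Ls \<Longrightarrow> M \<in> Ls \<Longrightarrow> L \<noteq> M \<Longrightarrow>
      v L M \<in> V \<and> v L M \<noteq> 0 \<and> (\<exists>l\<in>L. v L M + l \<in> M)"
    by metis
  \<comment> \<open>The vector \<open>e\<close> ensures that \<open>n\<close> is not orthogonal to
    all of \<open>V\<close> even when there is no pair of distinct planes; it exists because the
    ambient dimension is at least 3.\<close>
  have "dim V \<noteq> 0" using V(2) dim_ge_3 by linarith
  then obtain e where e: "e \<in> V" "e \<noteq> 0" by (auto simp: dim_eq_0)
  let ?\<A> = "(\<lambda>a. {n. a \<bullet> n = 0}) ` insert e ((\<lambda>(L, M). v L M) ` ?P)"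
  have "finite ?P" by (rule finite_subset[of _ "Ls \<times> Ls"]) (use finite_planes in auto)
  then have "finite ?\<A>" by blast
  moreover have "dim A < DIM('a)" if "A \<in> ?\<A>" for A
  proof -
    from that obtain a where a: "A = {n. a \<bullet> n = 0}" "a \<in> insert e ((\<lambda>(L, M). v L M) ` ?P)"
      by (rule imageE)
    from a(2) have "a = e \<or> (\<exists>L M. L \<in> Ls \<and> M \<in> Ls \<and> L \<noteq> M \<and> a = v L M)" by auto
    then have "a \<noteq> 0" using v e(2) by metis
    then show ?thesis using a(1) dim_ge_3 by (simp add: dim_hyperplane)
  qed
  ultimately have "\<exists>n. \<forall>A\<in>?\<A>. n \<notin> A"
    by (rule avoid_proper_subspaces)
  then obtain n where "\<forall>A\<in>?\<A>. n \<notin> A" ..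
  note n = bspec[OF this]
  have ne: "e \<bullet> n \<noteq> 0" using n[OF imageI[OF insertI1]] by simp
  have nv: "v L M \<bullet> n \<noteq> 0" if "L \<in> Ls" "M \<in> Ls" "L \<noteq> M" for L M
    using n[OF imageI[OF insertI2[OF imageI[of "(L, M)"]]]] that by simp
  define U where "U = V \<inter> {y. n \<bullet> y = 0}"
  have subU: "subspace U" unfolding U_def using V(1) subspace_hyperplane subspace_inter by blast
  have eU: "e \<notin> U" using ne by (simp add: U_def inner_commute)
  have "n \<noteq> 0" using ne by auto
  \<comment> \<open>The dimension formula bounds \<open>dim U\<close> from below; \<open>e\<close>
    being in \<open>V\<close> but not in \<open>U\<close> bounds it from above.\<close>
  have "dim (V \<union> {y. n \<bullet> y = 0}) + dim U = dim V + (DIM('a) - 1)"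
    unfolding U_def using dim_subspace_Un_Int[OF V(1) subspace_hyperplane[of n]]
      dim_hyperplane[OF \<open>n \<noteq> 0\<close>] by simp
  moreover have "dim (V \<union> {y. n \<bullet> y = 0}) \<le> DIM('a)" by (rule dim_subset_UNIV)
  ultimately have ge: "dim U + 3 \<ge> DIM('a)" using V(2) by linarith
  have ss: "span (insert e U) \<subseteq> V"
    using V(1) e(1) by (intro span_minimal) (auto simp: U_def)
  then have "dim U + 1 \<le> dim V"
    using dim_insert_subspace[OF subU eU] dim_subset by metis
  then have dU: "dim U + 3 = DIM('a)" using ge V(2) by linarith
  have eq: "V = span (insert e U)"
    using subspace_dim_equal[OF subspace_span V(1) ss] dim_insert_subspace[OF subU eU] dU V(2) by simp
  have UV: "U \<subseteq> V" by (auto simp: U_def)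
  have "\<not> M \<subseteq> span (U \<union> L)" if LM: "L \<in> Ls" "M \<in> Ls" "L \<noteq> M" for L M
  proof
    assume M: "M \<subseteq> span (U \<union> L)"
    obtain l where l: "l \<in> L" "v L M + l \<in> M" using v[OF LM] by blast
    then have "v L M + l \<in> span (U \<union> L)" using M by blast
    then obtain u l' where u: "u \<in> U" "l' \<in> L" "v L M + l = u + l'"
      using subU subspace_plane[OF LM(1)] by (auto simp: span_Un span_of_subspace)
    \<comment> \<open>Decompositions along \<open>V\<close> and \<open>L\<close> are unique, so
      \<open>v L M\<close> would equal \<open>u\<close> and lie in \<open>U\<close>, against the
      choice of \<open>n\<close>.\<close>
    have "v L M - u = l' - l" using u(3) by (simp add: algebra_simps)
    then have "v L M - u \<in> L" using u(2) l(1) subspace_plane[OF LM(1)] by (simp add: subspace_diff)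
    moreover have "v L M - u \<in> V" using v[OF LM] u UV V(1) by (auto intro: subspace_diff)
    moreover have "V \<inter> L = {0}" using V(3) LM(1) by (simp add: transverse_def)
    ultimately have "v L M - u = 0" by blast
    then have "v L M \<in> U" using u by simp
    then show False using nv[OF LM] by (simp add: U_def inner_commute)
  qed
  then have "separating U"
    using subU transverse_mono[OF V(3) subU UV] by (auto simp: separating_def)
  with that dU eU eq show thesis by blast
qed

lemma transverse_connected:
  assumes "subspace V" "dim V + 2 = DIM('a)" "transverse V"
    and "subspace V'" "dim V' + 2 = DIM('a)" "transverse V'"
  shows "connected_by_path V V'"
proof -
  obtain U x where U: "separating U" "dim U + 3 = DIM('a)" "x \<notin> U" "V = span (insert x U)"
    using transverse_has_separating[OF assms(1-3)] .
  obtain U' x' where U': "separating U'" "dim U' + 3 = DIM('a)" "x' \<notin> U'" "V' = span (insert x' U')"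
    using transverse_has_separating[OF assms(4-6)] .
  show ?thesis
    using connected_if_separating[of U U' x x'] U U' assms by blast
qed

end

section \<open>From planes back to 2-faces and their parallel classes\<close>

lemma dim_orthogonal_comp:
  fixes V :: "'a::euclidean_space set"
  assumes "subspace V"
  shows "dim (V\<^sup>\<bottom>) + dim V = DIM('a)"
proof -
  have "V\<^sup>\<bottom> = {y \<in> UNIV. \<forall>x\<in>V. orthogonal x y}"
    by (auto simp: orthogonal_comp_def)
  then show ?thesis
    using dim_subspace_orthogonal_to_vectors[OF assms subspace_UNIV] by simp
qed

lemma degenerates_orthogonal_comp_iff:
  assumes "subspace V" "two_face P F"
  shows "degenerates (V\<^sup>\<bottom>) F \<longleftrightarrow> V \<inter> direction_space F \<noteq> {0}"
  using degenerates_iff[OF subspace_orthogonal_comp] assms orthogonal_comp_self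
  by (metis two_face_def)

lemma admissible_orthogonal_iff:
  fixes V :: "'a::euclidean_space set"
  assumes "subspace V" "dim V = DIM('a) - 2" "DIM('a) \<ge> 2"
  shows "admissible_orthogonal P V \<longleftrightarrow> (\<forall>F. two_face P F \<longrightarrow> V \<inter> direction_space F = {0})"
  using assms dim_orthogonal_comp[OF assms(1)] degenerates_orthogonal_comp_iff[OF assms(1)]
  by (auto simp: admissible_orthogonal_def admissible_def subspace_orthogonal_comp)

text \<open>Degeneracy depends only on the direction space, so it holds for all members of a class
  or for none. Classes are nonempty, so a degenerating class has a degenerating member, and
  \<open>uniq\<close> fixes its direction.\<close>

lemma ex1_degenerating_class:
  assumes V: "subspace V" and F: "two_face P F" "V \<inter> direction_space F \<noteq> {0}"
    and uniq: "\<And>G. two_face P G \<Longrightarrow> V \<inter> direction_space G \<noteq> {0} \<Longrightarrow> direction_space G = direction_space F"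
  shows "\<exists>!C. C \<in> parallel_classes P \<and> class_degenerates (V\<^sup>\<bottom>) C"
proof -
  let ?r = "{(F, G). two_face P F \<and> two_face P G \<and> direction_space F = direction_space G}"
  have cls: "?r `` {G} = {H. two_face P H \<and> direction_space H = direction_space G}"
    if "two_face P G" for G using that by auto
  show ?thesis
  proof (rule ex1I[of _ "?r `` {F}"], intro conjI)
    show "?r `` {F} \<in> parallel_classes P"
      unfolding parallel_classes_def using F(1) by (intro quotientI) simp
    show "class_degenerates (V\<^sup>\<bottom>) (?r `` {F})"
      unfolding class_degenerates_def cls[OF F(1)]
      using degenerates_orthogonal_comp_iff[OF V] F(2) by auto
    fix C assume C: "C \<in> parallel_classes P \<and> class_degenerates (V\<^sup>\<bottom>) C"
    then obtain G where G: "two_face P G" "C = ?r `` {G}"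
      unfolding parallel_classes_def by (auto elim: quotientE)
    then have "G \<in> C" by simp
    then have "direction_space G = direction_space F"
      using C G(1) uniq degenerates_orthogonal_comp_iff[OF V] by (auto simp: class_degenerates_def)
    then show "C = ?r `` {F}" using G F(1) by auto
  qed
qed

lemma tuple_span_lin_indep:
  assumes "lin_indep_tuple k v"
  shows "subspace (tuple_span k v)" "dim (tuple_span k v) = k"
proof -
  have "dim (v ` {..<k}) = card (v ` {..<k})"
    using assms by (intro dim_eq_card_independent) (simp add: lin_indep_tuple_def)
  also have "\<dots> = k"
    using assms by (simp add: lin_indep_tuple_def card_image)
  finally show "dim (tuple_span k v) = k" by (simp add: tuple_span_def)
qed (simp add: tuple_span_def)

theorem theorem3:
  fixes P V0 V1 :: "(real ^ 'n) set"
  assumes "CARD('n) \<ge> 3"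
    and "polytope P" and "aff_dim P = int CARD('n)"
    and "admissible_orthogonal P V0" and "admissible_orthogonal P V1"
  shows "\<exists>\<gamma>. subspace_path (CARD('n) - 2) V0 V1 \<gamma> \<and>
    finite {t \<in> {0..1}. \<not> admissible_orthogonal P (tuple_span (CARD('n) - 2) (\<gamma> t))} \<and>
    (\<forall>t\<in>{0..1}. \<not> admissible_orthogonal P (tuple_span (CARD('n) - 2) (\<gamma> t)) \<longrightarrow>
       (\<exists>!C. C \<in> parallel_classes P \<and>
             class_degenerates ((tuple_span (CARD('n) - 2) (\<gamma> t))\<^sup>\<bottom>) C))"
proof -
  let ?k = "CARD('n) - 2"
  \<comment> \<open>Taking the image merges parallel faces, so \<open>L = M\<close> along a generic
    path means equality of parallel classes.\<close>
  define Ls where "Ls = direction_space ` {F. two_face P F}"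
  have face: "subspace (direction_space F) \<and> dim (direction_space F) = 2" if "two_face P F" for F
  proof -
    have "F \<noteq> {}" "aff_dim F = 2" using that by (auto simp: two_face_def)
    then show ?thesis using direction_space(1)[of F] dim_direction_space[of F] by simp
  qed
  have "finite {F. two_face P F}"
    by (rule finite_subset[OF _ finite_polytope_faces[OF assms(2)]]) (auto simp: two_face_def)
  then interpret plane_family Ls
    using assms(1) face by unfold_locales (auto simp: Ls_def)
  have transverse_iff: "transverse V \<longleftrightarrow> (\<forall>F. two_face P F \<longrightarrow> V \<inter> direction_space F = {0})" for V
    unfolding transverse_def by (auto simp: Ls_def)
  have adm: "admissible_orthogonal P V \<longleftrightarrow> transverse V" if "subspace V" "dim V = ?k" for V
    using admissible_orthogonal_iff[of V P] that assms(1) by (simp add: transverse_iff)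
  have V: "subspace V" "dim V + 2 = DIM(real ^ 'n)" "transverse V"
    if "admissible_orthogonal P V" for V
    using that adm[of V] assms(1) by (auto simp: admissible_orthogonal_def)
  have "connected_by_path V0 V1"
    by (intro transverse_connected V assms)
  then obtain \<gamma> where path: "subspace_path ?k V0 V1 \<gamma>"
    and fin: "finite {t \<in> {0..1}. \<not> transverse (tuple_span ?k (\<gamma> t))}"
    and uniq: "\<And>t L M. t \<in> {0..1} \<Longrightarrow> L \<in> Ls \<Longrightarrow> M \<in> Ls \<Longrightarrow> tuple_span ?k (\<gamma> t) \<inter> L \<noteq> {0} \<Longrightarrow>
        tuple_span ?k (\<gamma> t) \<inter> M \<noteq> {0} \<Longrightarrow> L = M"
    unfolding connected_by_path_def generic_path_def by auto
  have sp: "subspace (tuple_span ?k (\<gamma> t))" "dim (tuple_span ?k (\<gamma> t)) = ?k" if "t \<in> {0..1}" for t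
  proof -
    have "lin_indep_tuple ?k (\<gamma> t)" using path that by (simp add: subspace_path_def)
    then show "subspace (tuple_span ?k (\<gamma> t))" "dim (tuple_span ?k (\<gamma> t)) = ?k"
      by (rule tuple_span_lin_indep)+
  qed
  have admt: "admissible_orthogonal P (tuple_span ?k (\<gamma> t)) \<longleftrightarrow> transverse (tuple_span ?k (\<gamma> t))"
    if "t \<in> {0..1}" for t using adm sp[OF that] by blast
  show ?thesis
  proof (intro exI[of _ \<gamma>] conjI ballI impI)
    show "finite {t \<in> {0..1}. \<not> admissible_orthogonal P (tuple_span ?k (\<gamma> t))}"
      using fin by (rule rev_finite_subset) (use admt in auto)
    fix t :: real assume t: "t \<in> {0..1}" and "\<not> admissible_orthogonal P (tuple_span ?k (\<gamma> t))"
    then obtain F where F: "two_face P F" "tuple_span ?k (\<gamma> t) \<inter> direction_space F \<noteq> {0}"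
      using admt transverse_iff by metis
    show "\<exists>!C. C \<in> parallel_classes P \<and> class_degenerates ((tuple_span ?k (\<gamma> t))\<^sup>\<bottom>) C"
      using sp(1)[OF t] F
    proof (rule ex1_degenerating_class)
      show "direction_space G = direction_space F"
        if "two_face P G" "tuple_span ?k (\<gamma> t) \<inter> direction_space G \<noteq> {0}" for G
        using uniq[OF t _ _ that(2) F(2)] that(1) F(1) by (auto simp: Ls_def)
    qed
  qed (rule path)
qed

end
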